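(* Consider the Poisson $i\mathcal{S}$-graph with legitimate-node density $\lambda_\ell>0$, eavesdropper density $\lambda_{\mathrm e}>0$, path loss only with gain $g(r)=1/r^{2b}$, transmit power $P_\ell>0$, and common noise power $\sigma^2>0$. For the link between a typical node and its $i$-th closest neighbour, $i\ge1$, with maximum secrecy rate $\mathcal{R}_{\mathrm s,i}$, the probability of existence of a non-zero maximum secrecy rate, $p_{\mathrm{exist},i}=\mathbb{P}\{\mathcal{R}_{\mathrm s,i}>0\}$, is $$p_{\mathrm{exist},i}=\left(\frac{\lambda_\ell}{\lambda_\ell+\lambda_{\mathrm e}}\right)^{i},$$ and the probability of an outage, $p_{\mathrm{outage},i}(\varrho)=\mathbb{P}\{\mathcal{R}_{\mathrm s,i}<\varrho\}$ for $\varrho>0$, is $$p_{\mathrm{outage},i}(\varrho)=1-\frac{\ln 2\,(\pi\lambda_\ell)^{i}}{(i-1)!\,b}\left(\frac{P_\ell}{\sigma^2}\right)^{\frac ib}\int_{\varrho}^{+\infty}\frac{2^{z}}{(2^{z}-1)^{1+\frac ib}}\exp\left(-\pi\lambda_\ell\left(\frac{P_\ell/\sigma^2}{2^{z}-1}\right)^{\frac1b}-\pi\lambda_{\mathrm e}\left(\frac{P_\ell/\sigma^2}{2^{z-\varrho}-1}\right)^{\frac1b}\right)dz.$$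
   Context: $\Pi_\ell$ (legitimate nodes) and $\Pi_{\mathrm e}$ (eavesdroppers) are mutually independent homogeneous Poisson point processes on $\mathbb{R}^2$ with densities $\lambda_\ell,\lambda_{\mathrm e}$; $b>0$. The typical node is placed at the origin. $R_{\ell,1}\le R_{\ell,2}\le\cdots$ are the ordered distances from the origin to the points of $\Pi_\ell$, and $R_{\mathrm e,1}$ is the distance from the origin to the closest point of $\Pi_{\mathrm e}$. The maximum secrecy rate to the $i$-th closest legitimate node is $$\mathcal{R}_{\mathrm s,i}=\left[\log_2\left(1+\frac{P_\ell}{R_{\ell,i}^{2b}\sigma^2}\right)-\log_2\left(1+\frac{P_\ell}{R_{\mathrm e,1}^{2b}\sigma^2}\right)\right]^+,\qquad [t]^+=\max\{t,0\}.$$ *)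

theory Defs
  imports "HOL-Probability.Probability"
begin

text \<open>
  A (simple) point process is a random variable with values in the locally finite subsets of a
  Euclidean space, equipped with the smallest sigma-algebra making all counting maps
  \<open>X \<mapsto> card (X \<inter> B)\<close>, for bounded Borel sets \<open>B\<close>, measurable.
\<close>

definition locally_finite_sets :: "'a::euclidean_space set set" where
  "locally_finite_sets = {X. \<forall>B. bounded B \<longrightarrow> finite (X \<inter> B)}"

definition config_space :: "'a::euclidean_space set measure" where
  "config_space = sigma locally_finite_sets
     {{X \<in> locally_finite_sets. card (X \<inter> B) = n} | B n. B \<in> sets borel \<and> bounded B}"

definition poisson_point_process ::
  "'w measure \<Rightarrow> real \<Rightarrow> ('w \<Rightarrow> 'a::euclidean_space set) \<Rightarrow> bool" where
  "poisson_point_process M lam \<Phi> \<longleftrightarrow>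
     \<Phi> \<in> measurable M config_space \<and>
     (\<forall>B n. B \<in> sets borel \<longrightarrow> bounded B \<longrightarrow>
        \<P>(\<omega> in M. card (\<Phi> \<omega> \<inter> B) = n)
          = (lam * measure lborel B) ^ n / fact n * exp (- (lam * measure lborel B))) \<and>
     (\<forall>(m::nat) B. (\<forall>k<m. B k \<in> sets borel \<and> bounded (B k)) \<longrightarrow> disjoint_family_on B {..<m} \<longrightarrow>
        prob_space.indep_vars M (\<lambda>_. count_space UNIV) (\<lambda>k \<omega>. card (\<Phi> \<omega> \<inter> B k)) {..<m})"

text \<open>
  The \<open>i\<close>-th smallest distance (\<open>i \<ge> 1\<close>, counted with multiplicity) from the origin to the points
  of \<open>X\<close>. If \<open>X\<close> has fewer than \<open>i\<close> points the value is meaningless; for a Poisson process of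
  positive density this has probability zero.
\<close>

definition ordered_dist :: "'a::euclidean_space set \<Rightarrow> nat \<Rightarrow> real" where
  "ordered_dist X i = Inf {r. i \<le> card (X \<inter> cball 0 r)}"

lemma ordered_dist_enumeration:
  assumes X: "X \<in> locally_finite_sets"
    and f: "bij_betw f {1..} X"
    and mono: "\<And>i j. 1 \<le> i \<Longrightarrow> i \<le> j \<Longrightarrow> norm (f i) \<le> norm (f j)"
    and i: "1 \<le> (i::nat)"
  shows "ordered_dist X i = norm (f i)"
proof -
  have fin: "finite (X \<inter> cball 0 r)" for r
    using X by (auto simp: locally_finite_sets_def)
  have inj: "inj_on f {1..}" and img: "f ` {1..} = X"
    using f by (auto simp: bij_betw_def)
  have "i \<le> card (X \<inter> cball 0 r) \<longleftrightarrow> norm (f i) \<le> r" for r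
  proof
    assume r: "norm (f i) \<le> r"
    have "f ` {1..i} \<subseteq> X \<inter> cball 0 r"
      using img mono r by (force intro: order_trans)
    then have "card (f ` {1..i}) \<le> card (X \<inter> cball 0 r)"
      by (intro card_mono fin)
    moreover have "card (f ` {1..i}) = i"
      by (subst card_image) (auto intro: inj_on_subset[OF inj])
    ultimately show "i \<le> card (X \<inter> cball 0 r)" by simp
  next
    assume c: "i \<le> card (X \<inter> cball 0 r)"
    show "norm (f i) \<le> r"
    proof (rule ccontr)
      assume n: "\<not> norm (f i) \<le> r"
      have "X \<inter> cball 0 r \<subseteq> f ` {1..<i}"
      proof
        fix x assume x: "x \<in> X \<inter> cball 0 r"
        then obtain j where j: "1 \<le> j" "x = f j" using img by auto
        with x n mono[of i j] i have "j < i" by (cases "j < i") auto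
        with j show "x \<in> f ` {1..<i}" by auto
      qed
      then have "card (X \<inter> cball 0 r) \<le> card (f ` {1..<i})" by (intro card_mono) auto
      also have "\<dots> \<le> card {1..<i}" by (rule card_image_le) simp
      finally show False using c i by simp
    qed
  qed
  then have "{r. i \<le> card (X \<inter> cball 0 r)} = {norm (f i)..}" by auto
  then show ?thesis by (simp add: ordered_dist_def)
qed

definition path_gain :: "real \<Rightarrow> real \<Rightarrow> real" where
  "path_gain b r = 1 / r powr (2 * b)"

definition link_capacity :: "real \<Rightarrow> real \<Rightarrow> real \<Rightarrow> real \<Rightarrow> real" where
  "link_capacity P \<sigma> b r = log 2 (1 + P * path_gain b r / \<sigma>\<^sup>2)"

text \<open>
  The maximum secrecy rate from the typical node at the origin to its \<open>i\<close>-th closest legitimate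
  neighbour; \<open>L\<close> and \<open>E\<close> are the realisations of the legitimate nodes and of the eavesdroppers. The
  typical node is not itself a member of \<open>L\<close>.
\<close>

definition max_secrecy_rate ::
  "real \<Rightarrow> real \<Rightarrow> real \<Rightarrow> (real^2) set \<Rightarrow> (real^2) set \<Rightarrow> nat \<Rightarrow> real" where
  "max_secrecy_rate P \<sigma> b L E i =
     max (link_capacity P \<sigma> b (ordered_dist L i) - link_capacity P \<sigma> b (ordered_dist E 1)) 0"

end

theory Submission
  imports Defs
begin

text \<open>
  An \<open>i\<close>-th distance is at most \<open>r\<close> iff the disc of radius \<open>r\<close> contains at least \<open>i\<close> points, so the
  Poisson counts show that its square is Erlang distributed of order \<open>i\<close> with rate \<open>\<pi> \<lambda>\<close>. As a
  function of the squared distance the capacity is a decreasing bijection of the positive reals.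
  Hence the rate is positive iff \<open>U < V\<close> for the independent squared distances \<open>U\<close> and \<open>V\<close>, and for
  \<open>U = u\<close> given it is at least \<open>\<rho>\<close> iff \<open>V\<close> exceeds an explicit threshold. The exponential tail of
  \<open>V\<close> turns both probabilities into integrals over \<open>u\<close>; in the second one, the capacity \<open>z\<close> of the
  legitimate link is taken as the new variable.
\<close>

section \<open>Measurability of the ordered distances\<close>

lemma space_config_space [simp]: "space config_space = locally_finite_sets"
  unfolding config_space_def by (rule space_measure_of) auto

text \<open>The preimages of singletons are generators of the sigma-algebra, and singletons suffice
  because the naturals are countable.\<close>

lemma measurable_card_Int_config_space [measurable]:
  assumes "B \<in> sets borel" "bounded B"
  shows "(\<lambda>X. card (X \<inter> B)) \<in> measurable config_space (count_space UNIV)"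
proof (subst measurable_count_space_eq2_countable)
  have "(\<lambda>X. card (X \<inter> B)) -` {n} \<inter> space config_space \<in> sets config_space" for n
  proof -
    have "{X \<in> locally_finite_sets. card (X \<inter> B) = n} \<in> sets config_space"
      unfolding config_space_def using assms
      by (subst sets_measure_of) (auto intro!: sigma_sets.Basic)
    moreover have "(\<lambda>X. card (X \<inter> B)) -` {n} \<inter> space config_space =
        {X \<in> locally_finite_sets. card (X \<inter> B) = n}"
      by auto
    ultimately show ?thesis by simp
  qed
  then show "(\<lambda>X. card (X \<inter> B)) \<in> space config_space \<rightarrow> UNIV \<and>
      (\<forall>n\<in>UNIV. (\<lambda>X. card (X \<inter> B)) -` {n} \<inter> space config_space \<in> sets config_space)"
    by auto
qed

text \<open>By local finiteness the count in \<open>cball 0 r\<close> is right-continuous in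
  \<open>r\<close>, so the infimum is attained. The assumption on \<open>s\<close> excludes the junk
  case of an infimum over the empty set.\<close>

lemma ordered_dist_le_iff:
  assumes X: "X \<in> locally_finite_sets" and i: "1 \<le> i"
    and ex: "i \<le> card (X \<inter> cball 0 s)"
  shows "ordered_dist X i \<le> r \<longleftrightarrow> i \<le> card (X \<inter> cball 0 r)"
proof -
  define S where "S = {r. i \<le> card (X \<inter> cball 0 r)}"
  have fin: "finite (X \<inter> cball 0 r)" for r
    using X by (auto simp: locally_finite_sets_def)
  have "0 \<le> r" if "r \<in> S" for r
  proof (rule ccontr)
    assume "\<not> 0 \<le> r"
    then have "X \<inter> cball 0 r = {}" by (auto simp: not_le)
    with that i show False by (simp add: S_def)
  qed
  then have bdd: "bdd_below S" by (rule bdd_belowI)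
  have ne: "S \<noteq> {}" using ex by (auto simp: S_def)
  have "r \<in> S" if le: "Inf S \<le> r"
  proof -
    \<comment> \<open>\<open>N\<close> holds the norms of the points in the shell between
      \<open>r\<close> and \<open>r + 1\<close>, and \<open>r + 1\<close> itself in case there are
      none. No point has its norm strictly between \<open>r\<close> and \<open>Min N\<close>, so a
      radius \<open>t < Min N\<close> captures no points beyond \<open>cball 0 r\<close>.\<close>
    define N where "N = insert (r + 1) (norm ` {x \<in> X \<inter> cball 0 (r + 1). r < norm x})"
    have "{x \<in> X \<inter> cball 0 (r + 1). r < norm x} \<subseteq> X \<inter> cball 0 (r + 1)" by auto
    then have N: "finite N" "N \<noteq> {}"
      unfolding N_def using finite_subset[OF _ fin] by blast+
    have "r < Min N" using N by (subst Min_gr_iff) (auto simp: N_def)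
    with le have "Inf S < Min N" by simp
    then obtain t where t: "t \<in> S" "t < Min N" using cInf_lessD[OF ne] by blast
    have Min: "t < y" if "y \<in> N" for y using t(2) Min_le[OF N(1) that] by simp
    have "t < r + 1" using Min by (auto simp: N_def)
    have "X \<inter> cball 0 t \<subseteq> X \<inter> cball 0 r"
    proof safe
      fix x assume x: "x \<in> X" "x \<in> cball 0 t"
      show "x \<in> cball 0 r"
      proof (rule ccontr)
        assume "x \<notin> cball 0 r"
        with x \<open>t < r + 1\<close> have "norm x \<in> N" by (auto simp: N_def)
        from Min[OF this] x show False by simp
      qed
    qed
    then have "card (X \<inter> cball 0 t) \<le> card (X \<inter> cball 0 r)" by (intro card_mono fin)
    with t(1) show ?thesis by (simp add: S_def)
  qed
  moreover have "Inf S \<le> r" if "r \<in> S" using bdd that by (rule cInf_lower[rotated])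
  ultimately show ?thesis unfolding ordered_dist_def S_def[symmetric] by (auto simp: S_def)
qed

text \<open>By monotonicity of the counts, balls of integer radius decide whether an
  \<open>i\<close>-th point exists. The sublevel sets are therefore described by countably many
  counting maps.\<close>

lemma borel_measurable_ordered_dist [measurable]:
  assumes "1 \<le> i"
  shows "(\<lambda>X::'a::euclidean_space set. ordered_dist X i) \<in> borel_measurable config_space"
proof (subst borel_measurable_iff_le, intro allI)
  fix r
  \<comment> \<open>Configurations with fewer than \<open>i\<close> points all get the junk value \<open>Inf {}\<close>.\<close>
  have eq: "{X \<in> space config_space. ordered_dist X i \<le> r} =
    {X \<in> space config_space. if \<exists>n::nat. i \<le> card (X \<inter> cball (0::'a) (real n))
        then i \<le> card (X \<inter> cball 0 r) else Inf ({}::real set) \<le> r}"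
  proof (intro Collect_cong conj_cong refl)
    fix X :: "'a set" assume "X \<in> space config_space"
    then have X: "X \<in> locally_finite_sets" by simp
    show "ordered_dist X i \<le> r \<longleftrightarrow> (if \<exists>n::nat. i \<le> card (X \<inter> cball (0::'a) (real n))
        then i \<le> card (X \<inter> cball 0 r) else Inf ({}::real set) \<le> r)"
    proof (cases "\<exists>n::nat. i \<le> card (X \<inter> cball (0::'a) (real n))")
      case True
      then show ?thesis using ordered_dist_le_iff[OF X assms] by auto
    next
      case False
      have "\<not> i \<le> card (X \<inter> cball 0 s)" for s
      proof
        assume i: "i \<le> card (X \<inter> cball 0 s)"
        obtain n :: nat where "s \<le> real n" using real_arch_simple by blast
        then have "card (X \<inter> cball 0 s) \<le> card (X \<inter> cball 0 (real n))"
          using X by (intro card_mono) (auto simp: locally_finite_sets_def)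
        with i False show False by (meson order_trans)
      qed
      then have "{r. i \<le> card (X \<inter> cball 0 r)} = {}" by auto
      with False show ?thesis unfolding ordered_dist_def by simp
    qed
  qed
  show "{X::'a set \<in> space config_space. ordered_dist X i \<le> r} \<in> sets config_space"
    unfolding eq by measurable
qed

section \<open>Poisson counts and the law of the squared ordered distances\<close>

lemma (in prob_space) prob_poisson_ge:
  assumes \<Phi>: "poisson_point_process M lam \<Phi>" and B: "B \<in> sets borel" "bounded B"
  shows "\<P>(\<omega> in M. i \<le> card (\<Phi> \<omega> \<inter> B)) =
    1 - (\<Sum>n<i. (lam * measure lborel B) ^ n / fact n * exp (- (lam * measure lborel B)))"
proof -
  have [measurable]: "\<Phi> \<in> measurable M config_space"
    using \<Phi> by (simp add: poisson_point_process_def)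
  note [measurable] = measurable_compose[OF this measurable_card_Int_config_space[OF B]]
  have eq: "{\<omega>\<in>space M. i \<le> card (\<Phi> \<omega> \<inter> B)} =
      space M - (\<Union>n<i. {\<omega>\<in>space M. card (\<Phi> \<omega> \<inter> B) = n})"
    by (auto simp: not_less)
  have "\<P>(\<omega> in M. i \<le> card (\<Phi> \<omega> \<inter> B)) =
      1 - prob (\<Union>n<i. {\<omega>\<in>space M. card (\<Phi> \<omega> \<inter> B) = n})"
    unfolding eq by (rule prob_compl) measurable
  also have "prob (\<Union>n<i. {\<omega>\<in>space M. card (\<Phi> \<omega> \<inter> B) = n}) =
      (\<Sum>n<i. \<P>(\<omega> in M. card (\<Phi> \<omega> \<inter> B) = n))"
    by (rule finite_measure_finite_Union) (auto simp: disjoint_family_on_def)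
  also have "\<dots> = (\<Sum>n<i. (lam * measure lborel B) ^ n / fact n * exp (- (lam * measure lborel B)))"
    using \<Phi> B by (simp add: poisson_point_process_def)
  finally show ?thesis .
qed

lemma measure_lborel_cball_plane:
  "0 \<le> r \<Longrightarrow> measure lborel (cball (0::real^2) r) = pi * r\<^sup>2"
  using content_cball[of r "0::real^2"] by (simp add: unit_ball_vol_2)

lemma (in prob_space) prob_poisson_cball_ge:
  fixes \<Phi> :: "'a \<Rightarrow> (real^2) set"
  assumes \<Phi>: "poisson_point_process M lam \<Phi>" and "0 \<le> r" "1 \<le> i"
  shows "\<P>(\<omega> in M. i \<le> card (\<Phi> \<omega> \<inter> cball 0 r)) = erlang_CDF (i - 1) (pi * lam) (r\<^sup>2)"
proof -
  \<comment> \<open>\<open>erlang_CDF k\<close> subtracts the Poisson terms with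
    \<open>n \<le> k\<close>, so "fewer than \<open>i\<close> points" corresponds to
    \<open>k = i - 1\<close>.\<close>
  have "{..<i} = {..i - 1}" using \<open>1 \<le> i\<close> by auto
  then show ?thesis
    using assms by (simp add: prob_poisson_ge[OF \<Phi>] measure_lborel_cball_plane erlang_CDF_def mult_ac)
qed

lemma tendsto_erlang_CDF_at_top:
  assumes "0 < l"
  shows "(erlang_CDF k l \<longlongrightarrow> 1) at_top"
proof -
  have lim: "filterlim (\<lambda>x. l * x) at_top at_top"
    using assms by (intro filterlim_tendsto_pos_mult_at_top[OF tendsto_const]) (auto simp: filterlim_ident)
  have "((\<lambda>x. 1 - (\<Sum>n\<le>k. (l * x) ^ n / exp (l * x) / fact n)) \<longlongrightarrow> 1 - (\<Sum>n\<le>k. 0 / fact n)) at_top"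
    by (intro tendsto_intros filterlim_compose[OF tendsto_power_div_exp_0 lim]) auto
  moreover have "\<forall>\<^sub>F x in at_top. 1 - (\<Sum>n\<le>k. (l * x) ^ n / exp (l * x) / fact n) = erlang_CDF k l x"
    using eventually_ge_at_top[of 0]
    by eventually_elim (auto simp: erlang_CDF_def exp_minus field_simps)
  ultimately show ?thesis by (simp add: tendsto_cong)
qed

text \<open>The balls of integer radius \<open>n\<close> give the lower bounds
  \<open>erlang_CDF (i - 1) (pi * lam) (n\<^sup>2)\<close>, which tend to 1. Hence
  \<open>ordered_dist\<close> is almost surely not a junk value.\<close>

lemma (in prob_space) AE_poisson_ge:
  fixes \<Phi> :: "'a \<Rightarrow> (real^2) set"
  assumes \<Phi>: "poisson_point_process M lam \<Phi>" and lam: "0 < lam" and i: "1 \<le> i"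
  shows "AE \<omega> in M. \<exists>s. i \<le> card (\<Phi> \<omega> \<inter> cball 0 s)"
proof -
  have [measurable]: "\<Phi> \<in> measurable M config_space"
    using \<Phi> by (simp add: poisson_point_process_def)
  let ?A = "{\<omega>\<in>space M. \<exists>n::nat. i \<le> card (\<Phi> \<omega> \<inter> cball 0 (real n))}"
  have A: "?A \<in> sets M" by measurable
  have "erlang_CDF (i - 1) (pi * lam) ((real n)\<^sup>2) \<le> prob ?A" for n
    unfolding prob_poisson_cball_ge[OF \<Phi> of_nat_0_le_iff i, symmetric]
    by (rule finite_measure_mono[OF _ A]) auto
  moreover have "(\<lambda>n. erlang_CDF (i - 1) (pi * lam) ((real n)\<^sup>2)) \<longlonglongrightarrow> 1"
    using lam
    by (intro filterlim_compose[OF tendsto_erlang_CDF_at_top] filterlim_pow_at_top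
        filterlim_real_sequentially) auto
  ultimately have "1 \<le> prob ?A" by (intro LIMSEQ_le_const2) auto
  then have "prob ?A = 1" by (intro antisym) auto
  then have "AE \<omega> in M. \<omega> \<in> ?A" using A by (simp add: prob_eq_1)
  then show ?thesis by eventually_elim auto
qed

lemma (in prob_space) AE_ordered_dist_le_iff:
  fixes \<Phi> :: "'a \<Rightarrow> (real^2) set"
  assumes \<Phi>: "poisson_point_process M lam \<Phi>" and lam: "0 < lam" and i: "1 \<le> i"
  shows "AE \<omega> in M. \<forall>r. ordered_dist (\<Phi> \<omega>) i \<le> r \<longleftrightarrow> i \<le> card (\<Phi> \<omega> \<inter> cball 0 r)"
  using AE_poisson_ge[OF assms] AE_space
proof eventually_elim
  case (elim \<omega>)
  have "\<Phi> \<omega> \<in> locally_finite_sets"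
    using \<Phi> elim(2) measurable_space[of \<Phi> M config_space] by (simp add: poisson_point_process_def)
  with elim(1) show ?case using ordered_dist_le_iff[OF _ i] by blast
qed

lemma (in prob_space) prob_ordered_dist_le:
  fixes \<Phi> :: "'a \<Rightarrow> (real^2) set"
  assumes \<Phi>: "poisson_point_process M lam \<Phi>" and lam: "0 < lam" and i: "1 \<le> i" and r: "0 \<le> r"
  shows "\<P>(\<omega> in M. ordered_dist (\<Phi> \<omega>) i \<le> r) = erlang_CDF (i - 1) (pi * lam) (r\<^sup>2)"
proof -
  have [measurable]: "\<Phi> \<in> measurable M config_space"
    using \<Phi> by (simp add: poisson_point_process_def)
  have "\<P>(\<omega> in M. ordered_dist (\<Phi> \<omega>) i \<le> r) = \<P>(\<omega> in M. i \<le> card (\<Phi> \<omega> \<inter> cball 0 r))"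
  proof (rule prob_eq_AE)
    show "AE \<omega> in M. ordered_dist (\<Phi> \<omega>) i \<le> r \<longleftrightarrow> i \<le> card (\<Phi> \<omega> \<inter> cball 0 r)"
      using AE_ordered_dist_le_iff[OF \<Phi> lam i] by eventually_elim auto
    have [measurable]: "(\<lambda>\<omega>. ordered_dist (\<Phi> \<omega>) i) \<in> borel_measurable M"
      by (rule measurable_compose[OF _ borel_measurable_ordered_dist[OF i]]) measurable
    show "{\<omega>\<in>space M. ordered_dist (\<Phi> \<omega>) i \<le> r} \<in> events" by measurable
    show "{\<omega>\<in>space M. i \<le> card (\<Phi> \<omega> \<inter> cball 0 r)} \<in> events" by measurable
  qed
  then show ?thesis by (simp add: prob_poisson_cball_ge[OF \<Phi> r i])
qed

text \<open>This discards both a point at the origin, where division by zero would make the gain 0,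
  and an unspecified infimum of the empty set. It holds because the Erlang distribution function
  vanishes at 0.\<close>

lemma (in prob_space) AE_ordered_dist_pos:
  fixes \<Phi> :: "'a \<Rightarrow> (real^2) set"
  assumes \<Phi>: "poisson_point_process M lam \<Phi>" and lam: "0 < lam" and i: "1 \<le> i"
  shows "AE \<omega> in M. 0 < ordered_dist (\<Phi> \<omega>) i"
proof -
  have [measurable]: "\<Phi> \<in> measurable M config_space"
    using \<Phi> by (simp add: poisson_point_process_def)
  have [measurable]: "(\<lambda>\<omega>. ordered_dist (\<Phi> \<omega>) i) \<in> borel_measurable M"
    by (rule measurable_compose[OF _ borel_measurable_ordered_dist[OF i]]) measurable
  have "\<P>(\<omega> in M. ordered_dist (\<Phi> \<omega>) i \<le> 0) = 0"
    using prob_ordered_dist_le[OF assms, of 0] by (simp add: erlang_CDF_at0)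
  then have "AE \<omega> in M. \<not> ordered_dist (\<Phi> \<omega>) i \<le> 0"
    by (subst (asm) prob_Collect_eq_0) auto
  then show ?thesis by eventually_elim auto
qed

text \<open>The mean count in a disc is linear in the squared radius, so it is the square of the
  distance that has an Erlang law. For \<open>i = 1\<close> this law is exponential.\<close>

lemma (in prob_space) distributed_ordered_dist_square:
  fixes \<Phi> :: "'a \<Rightarrow> (real^2) set"
  assumes \<Phi>: "poisson_point_process M lam \<Phi>" and lam: "0 < lam" and i: "1 \<le> i"
  shows "distributed M lborel (\<lambda>\<omega>. (ordered_dist (\<Phi> \<omega>) i)\<^sup>2) (erlang_density (i - 1) (pi * lam))"
proof (rule erlang_distributedI)
  have [measurable]: "\<Phi> \<in> measurable M config_space"
    using \<Phi> by (simp add: poisson_point_process_def)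
  have [measurable]: "(\<lambda>\<omega>. ordered_dist (\<Phi> \<omega>) i) \<in> borel_measurable M"
    by (rule measurable_compose[OF _ borel_measurable_ordered_dist[OF i]]) measurable
  show "(\<lambda>\<omega>. (ordered_dist (\<Phi> \<omega>) i)\<^sup>2) \<in> borel_measurable M" by measurable
  show "0 < pi * lam" using lam by simp
  fix a :: real assume "0 \<le> a"
  have "\<P>(\<omega> in M. (ordered_dist (\<Phi> \<omega>) i)\<^sup>2 \<le> a) = \<P>(\<omega> in M. ordered_dist (\<Phi> \<omega>) i \<le> sqrt a)"
  proof (rule prob_eq_AE)
    show "AE \<omega> in M. (ordered_dist (\<Phi> \<omega>) i)\<^sup>2 \<le> a \<longleftrightarrow> ordered_dist (\<Phi> \<omega>) i \<le> sqrt a"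
      using AE_ordered_dist_pos[OF assms]
      by eventually_elim (auto intro: real_le_rsqrt dest: real_le_rsqrt simp: real_le_lsqrt sqrt_ge_absD)
  qed measurable
  also have "\<dots> = erlang_CDF (i - 1) (pi * lam) a"
    using \<open>0 \<le> a\<close> by (simp add: prob_ordered_dist_le[OF assms])
  finally show "emeasure M {\<omega>\<in>space M. (ordered_dist (\<Phi> \<omega>) i)\<^sup>2 \<le> a} = erlang_CDF (i - 1) (pi * lam) a"
    by (simp add: emeasure_eq_measure)
qed

section \<open>Conditioning on one of two independent variables, and substitution in
  integrals\<close>

text \<open>By independence the joint law is a product, and Fubini integrates the conditional
  probability \<open>F u\<close> against the density of \<open>U\<close>. \<open>F\<close> has to be
  correct only where \<open>f\<close> is positive, which permits formulas that fail for negative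
  \<open>u\<close>.\<close>

lemma (in prob_space) prob_indep_distributed:
  fixes f :: "real \<Rightarrow> real" and Q :: "real \<Rightarrow> real \<Rightarrow> bool"
  assumes U: "distributed M lborel U (\<lambda>u. ennreal (f u))" and f: "\<And>u. 0 \<le> f u"
    and f_meas [measurable]: "f \<in> borel_measurable borel"
    and indep: "indep_var borel U borel V"
    and Q [measurable]: "Measurable.pred (borel \<Otimes>\<^sub>M borel) (\<lambda>(u, v). Q u v)"
    and F: "\<And>u. 0 < f u \<Longrightarrow> \<P>(\<omega> in M. Q u (V \<omega>)) = F u"
    and F_meas [measurable]: "F \<in> borel_measurable borel" and F0: "\<And>u. 0 \<le> F u"
  shows "\<P>(\<omega> in M. Q (U \<omega>) (V \<omega>)) = (LINT u|lborel. f u * F u)"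
proof -
  have [measurable]: "U \<in> borel_measurable M" "V \<in> borel_measurable M"
    using indep by (auto dest: indep_var_rv1 indep_var_rv2)
  interpret V: prob_space "distr M borel V" by (rule prob_space_distr) measurable
  let ?A = "{x \<in> space (borel \<Otimes>\<^sub>M borel). Q (fst x) (snd x)}"
  have A[measurable]: "?A \<in> sets (borel \<Otimes>\<^sub>M borel)" using Q by (simp add: case_prod_beta' pred_def)
  have "emeasure M {\<omega>\<in>space M. Q (U \<omega>) (V \<omega>)} =
      emeasure (distr M (borel \<Otimes>\<^sub>M borel) (\<lambda>\<omega>. (U \<omega>, V \<omega>))) ?A"
    by (subst emeasure_distr[OF _ A]) (auto intro!: arg_cong2[where f=emeasure] simp: space_pair_measure)
  also have "\<dots> = emeasure (distr M borel U \<Otimes>\<^sub>M distr M borel V) ?A"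
    using indep by (simp add: indep_var_distribution_eq)
  also have "\<dots> = (\<integral>\<^sup>+u. emeasure (distr M borel V) (Pair u -` ?A) \<partial>distr M borel U)"
    by (rule V.emeasure_pair_measure_alt) simp
  also have "distr M borel U = density lborel (\<lambda>u. ennreal (f u))"
    using distributed_distr_eq_density[OF U] by (simp cong: distr_cong)
  also have "(\<integral>\<^sup>+u. emeasure (distr M borel V) (Pair u -` ?A) \<partial>\<dots>) =
      (\<integral>\<^sup>+u. ennreal (f u) * emeasure (distr M borel V) (Pair u -` ?A) \<partial>lborel)"
    by (rule nn_integral_density) (auto intro!: V.measurable_emeasure_Pair simp: sets_pair_measure_cong)
  also have "\<dots> = (\<integral>\<^sup>+u. ennreal (f u * F u) \<partial>lborel)"
  proof (rule nn_integral_cong)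
    fix u
    show "ennreal (f u) * emeasure (distr M borel V) (Pair u -` ?A) = ennreal (f u * F u)"
    proof (cases "f u = 0")
      case False
      with f[of u] have "0 < f u" by simp
      have "Pair u -` ?A \<in> sets borel" using sets_Pair1[OF A] .
      then have "emeasure (distr M borel V) (Pair u -` ?A) = emeasure M {\<omega>\<in>space M. Q u (V \<omega>)}"
        by (subst emeasure_distr) (auto intro!: arg_cong2[where f=emeasure] simp: space_pair_measure)
      also have "\<dots> = ennreal (F u)" using F[OF \<open>0 < f u\<close>] by (simp add: emeasure_eq_measure)
      finally show ?thesis using f F0 by (simp add: ennreal_mult)
    qed simp
  qed
  finally have "\<P>(\<omega> in M. Q (U \<omega>) (V \<omega>)) = enn2real (\<integral>\<^sup>+u. ennreal (f u * F u) \<partial>lborel)"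
    by (simp add: measure_def)
  also have "\<dots> = (LINT u|lborel. f u * F u)"
    using f F0 by (subst integral_eq_nn_integral) auto
  finally show ?thesis .
qed

text \<open>The law has no atoms, so the strict and the weak tail agree. The weak one is needed for
  the complement of an outage.\<close>

lemma (in prob_space) exponential_distributed_ge:
  assumes V: "distributed M lborel V (exponential_density l)" and "0 < l" "0 \<le> a"
  shows "\<P>(\<omega> in M. a \<le> V \<omega>) = exp (- a * l)"
proof -
  have [measurable]: "V \<in> borel_measurable M" using distributed_measurable[OF V] by simp
  have "AE \<omega> in M. V \<omega> \<noteq> a"
    by (subst distributed_AE2[OF V, of "\<lambda>v. v \<noteq> a"]) (auto intro: AE_mp[OF AE_lborel_singleton[of a]])
  then have "\<P>(\<omega> in M. a \<le> V \<omega>) = \<P>(\<omega> in M. a < V \<omega>)"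
    by (intro prob_eq_AE) (auto elim!: eventually_mono)
  then show ?thesis using exponential_distributedD_gt[OF V] assms by simp
qed

text \<open>The substitution rule for absolutely integrable functions lives on the completion of
  \<open>lborel\<close>; for Borel functions it transfers back. The absolute value of the derivative
  covers decreasing substitutions.\<close>

lemma set_lborel_integral_change_of_variables:
  fixes g g' h :: "real \<Rightarrow> real"
  assumes S [measurable]: "S \<in> sets borel"
    and deriv: "\<And>x. x \<in> S \<Longrightarrow> (g has_real_derivative g' x) (at x)"
    and inj: "inj_on g S"
    and [measurable]: "g \<in> borel_measurable borel" "g' \<in> borel_measurable borel" "h \<in> borel_measurable borel"
    and h: "set_integrable lborel (g ` S) h"
  shows "(LINT y:g ` S|lborel. h y) = (LINT x:S|lborel. \<bar>g' x\<bar> * h (g x))"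
proof -
  have abs_h: "h absolutely_integrable_on g ` S"
    using h unfolding set_integrable_def by (subst integrable_completion) auto
  have *: "(\<lambda>x. \<bar>g' x\<bar> * h (g x)) absolutely_integrable_on S \<and>
      integral S (\<lambda>x. \<bar>g' x\<bar> * h (g x)) = integral (g ` S) h"
    using abs_h by (subst has_absolute_integral_change_of_variables_1'[OF _ _ inj])
      (auto intro: DERIV_subset deriv)
  then have "set_integrable lborel S (\<lambda>x. \<bar>g' x\<bar> * h (g x))"
    unfolding set_integrable_def by (subst (asm) integrable_completion) auto
  with * h show ?thesis by (simp add: set_borel_integral_eq_integral)
qed

section \<open>The capacity as a function of the squared distance, and its inverse\<close>

text \<open>Here \<open>c\<close> stands for \<open>P / \<sigma>\<^sup>2\<close>; passing to the
  squared distance turns the exponent \<open>2 * b\<close> into \<open>b\<close>.\<close>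

definition sq_dist_capacity :: "real \<Rightarrow> real \<Rightarrow> real \<Rightarrow> real" where
  "sq_dist_capacity c b u = log 2 (1 + c / u powr b)"

text \<open>The inverse of \<open>sq_dist_capacity c b\<close> on the positive reals, for positive
  \<open>c\<close> and \<open>b\<close>.\<close>

definition capacity_sq_dist :: "real \<Rightarrow> real \<Rightarrow> real \<Rightarrow> real" where
  "capacity_sq_dist c b z = (c / (2 powr z - 1)) powr (1 / b)"

lemma borel_measurable_sq_dist_capacity [measurable]: "sq_dist_capacity c b \<in> borel_measurable borel"
  unfolding sq_dist_capacity_def[abs_def] by measurable

lemma borel_measurable_capacity_sq_dist [measurable]: "capacity_sq_dist c b \<in> borel_measurable borel"
  unfolding capacity_sq_dist_def[abs_def] by measurable

lemma link_capacity_eq_sq_dist_capacity: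
  assumes "0 < r"
  shows "link_capacity P \<sigma> b r = sq_dist_capacity (P / \<sigma>\<^sup>2) b (r\<^sup>2)"
proof -
  have "(r\<^sup>2) powr b = r powr (2 * b)"
    using assms by (simp add: powr_powr flip: powr_numeral)
  then show ?thesis by (simp add: link_capacity_def path_gain_def sq_dist_capacity_def mult.commute)
qed

lemma powr_two_gt_one: "0 < z \<Longrightarrow> 1 < 2 powr (z::real)"
  using powr_less_mono[of 0 z 2] by simp

context
  fixes c b :: real
  assumes c: "0 < c" and b: "0 < b"
begin

lemma sq_dist_capacity_pos: "0 < u \<Longrightarrow> 0 < sq_dist_capacity c b u"
  using c by (simp add: sq_dist_capacity_def add_pos_pos)

lemma capacity_sq_dist_pos: "0 < z \<Longrightarrow> 0 < capacity_sq_dist c b z"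
  using c powr_two_gt_one[of z] by (simp add: capacity_sq_dist_def)

lemma sq_dist_capacity_inverse:
  assumes "0 < z" shows "sq_dist_capacity c b (capacity_sq_dist c b z) = z"
proof -
  have "1 < 2 powr z" using assms by (rule powr_two_gt_one)
  then have "c / capacity_sq_dist c b z powr b = 2 powr z - 1"
    using c b by (simp add: capacity_sq_dist_def powr_powr)
  then show ?thesis by (simp add: sq_dist_capacity_def)
qed

lemma sq_dist_capacity_strict_antimono:
  assumes "0 < u" "u < v"
  shows "sq_dist_capacity c b v < sq_dist_capacity c b u"
proof -
  have "u powr b < v powr b" using assms b by (intro powr_less_mono2) auto
  then have "c / v powr b < c / u powr b" using assms c by (intro divide_strict_left_mono) auto
  moreover have "0 < c / v powr b" using assms c by simp
  ultimately show ?thesis unfolding sq_dist_capacity_def by (subst log_less_cancel_iff) linarith+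
qed

lemma sq_dist_capacity_less_iff:
  assumes "0 < u" "0 < v"
  shows "sq_dist_capacity c b v < sq_dist_capacity c b u \<longleftrightarrow> u < v"
  using assms by (metis less_asym linorder_neq_iff sq_dist_capacity_strict_antimono)

lemma sq_dist_capacity_le_iff:
  assumes "0 < v" "0 < z"
  shows "sq_dist_capacity c b v \<le> z \<longleftrightarrow> capacity_sq_dist c b z \<le> v"
  using sq_dist_capacity_less_iff[OF assms(1) capacity_sq_dist_pos[OF assms(2)]]
    sq_dist_capacity_inverse[OF assms(2)]
    sq_dist_capacity_less_iff[OF capacity_sq_dist_pos[OF assms(2)] assms(1)]
  by (auto simp: not_less[symmetric])

lemma less_sq_dist_capacity_iff:
  assumes "0 < v" "0 < z"
  shows "z < sq_dist_capacity c b v \<longleftrightarrow> v < capacity_sq_dist c b z"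
  using sq_dist_capacity_le_iff[OF assms] by (auto simp: not_le[symmetric])

lemma capacity_sq_dist_inverse:
  assumes "0 < u" shows "capacity_sq_dist c b (sq_dist_capacity c b u) = u"
proof -
  note pos = capacity_sq_dist_pos[OF sq_dist_capacity_pos[OF assms]]
  have "sq_dist_capacity c b (capacity_sq_dist c b (sq_dist_capacity c b u)) = sq_dist_capacity c b u"
    by (rule sq_dist_capacity_inverse[OF sq_dist_capacity_pos[OF assms]])
  then show ?thesis
    using sq_dist_capacity_less_iff[OF assms pos] sq_dist_capacity_less_iff[OF pos assms] by simp
qed

text \<open>The bijection reverses the order, so capacities above \<open>\<rho>\<close> match
  squared distances below the threshold. This is the domain of the later substitution.\<close>

lemma capacity_sq_dist_image:
  assumes "0 < \<rho>"
  shows "capacity_sq_dist c b ` {\<rho><..} = {0<..<capacity_sq_dist c b \<rho>}"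
proof (intro equalityI subsetI)
  fix u assume "u \<in> capacity_sq_dist c b ` {\<rho><..}"
  then obtain z where z: "\<rho> < z" "u = capacity_sq_dist c b z" by auto
  with assms have "0 < u" "\<rho> < sq_dist_capacity c b u"
    by (auto simp: capacity_sq_dist_pos sq_dist_capacity_inverse)
  then show "u \<in> {0<..<capacity_sq_dist c b \<rho>}" using less_sq_dist_capacity_iff[OF _ assms] by auto
next
  fix u assume u: "u \<in> {0<..<capacity_sq_dist c b \<rho>}"
  then have "sq_dist_capacity c b u \<in> {\<rho><..}" using less_sq_dist_capacity_iff[OF _ assms] by auto
  moreover have "capacity_sq_dist c b (sq_dist_capacity c b u) = u"
    using u by (simp add: capacity_sq_dist_inverse)
  ultimately show "u \<in> capacity_sq_dist c b ` {\<rho><..}" by force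
qed

text \<open>The case \<open>k = 1\<close> is the form that gets differentiated; general
  \<open>k\<close> gives the factor \<open>u ^ k\<close> of the Erlang density after the
  substitution.\<close>

lemma capacity_sq_dist_power:
  assumes "0 < z"
  shows "capacity_sq_dist c b z ^ k = c powr (real k / b) * (2 powr z - 1) powr - (real k / b)"
proof -
  have "capacity_sq_dist c b z ^ k = (c / (2 powr z - 1)) powr (real k / b)"
    using capacity_sq_dist_pos[OF assms]
    by (simp add: powr_realpow[symmetric]) (simp add: capacity_sq_dist_def powr_powr)
  then show ?thesis
    using c powr_two_gt_one[OF assms] by (simp add: powr_divide powr_minus_divide)
qed

lemma DERIV_capacity_sq_dist:
  assumes "0 < z"
  shows "(capacity_sq_dist c b has_real_derivative
    - (ln 2 / b * c powr (1 / b) * 2 powr z * (2 powr z - 1) powr (- 1 / b - 1))) (at z)"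
proof (rule has_field_derivative_transform_within)
  have z: "1 < 2 powr z" using assms by (rule powr_two_gt_one)
  show "((\<lambda>z. c powr (1 / b) * (2 powr z - 1) powr (- 1 / b)) has_real_derivative
    - (ln 2 / b * c powr (1 / b) * 2 powr z * (2 powr z - 1) powr (- 1 / b - 1))) (at z)"
    using z by (auto intro!: derivative_eq_intros)
  \<comment> \<open>The closed form agrees with \<open>capacity_sq_dist\<close> at positive
    arguments, so the neighbourhood of \<open>z\<close> is given radius \<open>z\<close>.\<close>
  show "0 < z" "z \<in> UNIV" by (fact, simp)
  fix y assume "dist y z < z"
  then have "0 < y" by (simp add: dist_real_def)
  then show "c powr (1 / b) * (2 powr y - 1) powr (- 1 / b) = capacity_sq_dist c b y"
    using capacity_sq_dist_power[of y 1] by simp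
qed

end

section \<open>The two integrals against the Erlang density\<close>

lemma has_bochner_integral_erlang_density:
  assumes "0 < l"
  shows "has_bochner_integral lborel (erlang_density k l) 1"
  using nn_integral_erlang_ith_moment[OF assms, of k 0] assms
  by (intro has_bochner_integral_nn_integral) auto

text \<open>Exponential tilting: the factor \<open>exp (- m * u)\<close> turns the Erlang density of
  rate \<open>l\<close> into a multiple of the one of rate \<open>l + m\<close>, whose total mass is
  1.\<close>

lemma integral_erlang_density_mult_exp:
  assumes "0 < l" "0 < m"
  shows "(LINT u|lborel. erlang_density k l u * exp (- m * u)) = (l / (l + m)) ^ Suc k"
proof -
  have p: "l ^ Suc k = (l / (l + m)) ^ Suc k * (l + m) ^ Suc k"
    using assms unfolding power_mult_distrib[symmetric] by simp
  have e: "exp (- (l + m) * u) = exp (- l * u) * exp (- m * u)" for u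
    by (simp add: algebra_simps flip: exp_add)
  have "erlang_density k l u * exp (- m * u) = (l / (l + m)) ^ Suc k * erlang_density k (l + m) u" for u
    unfolding erlang_density_def p e
    by (cases "u < 0") (simp_all only: if_True if_False mult_zero_left mult_zero_right
        times_divide_eq_left times_divide_eq_right mult_ac)
  then show ?thesis
    using has_bochner_integral_integral_eq[OF has_bochner_integral_erlang_density[of "l + m" k]] assms
    by simp
qed

text \<open>Substitute \<open>u = capacity_sq_dist c b z\<close>. Then
  \<open>sq_dist_capacity c b u\<close> becomes \<open>z\<close> and the range of \<open>u\<close>
  becomes \<open>z > \<rho>\<close>.\<close>

lemma integral_erlang_density_outage:
  assumes c: "0 < c" and b: "0 < b" and l: "0 < l" and m: "0 < m" and \<rho>: "0 < \<rho>"
  shows "(LINT u|lborel. erlang_density k l u * (indicator {0<..<capacity_sq_dist c b \<rho>} u *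
      exp (- m * capacity_sq_dist c b (sq_dist_capacity c b u - \<rho>)))) =
    ln 2 * l ^ Suc k / (fact k * b) * c powr (real (Suc k) / b) *
      (LINT z:{\<rho><..}|lborel. 2 powr z / (2 powr z - 1) powr (1 + real (Suc k) / b) *
        exp (- (l * (c / (2 powr z - 1)) powr (1 / b)) - m * (c / (2 powr (z - \<rho>) - 1)) powr (1 / b)))"
    (is "?lhs = ?C * (LINT z:_|lborel. ?g z)")
proof -
  let ?G = "capacity_sq_dist c b"
  define h where "h u = erlang_density k l u * exp (- m * ?G (sq_dist_capacity c b u - \<rho>))" for u
  define G' where "G' z = - (ln 2 / b * c powr (1 / b) * 2 powr z * (2 powr z - 1) powr (- 1 / b - 1))" for z
  have [measurable]: "h \<in> borel_measurable borel" "G' \<in> borel_measurable borel"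
    unfolding h_def[abs_def] G'_def[abs_def] by measurable
  note image = capacity_sq_dist_image[OF c b \<rho>]
  have "integrable lborel (erlang_density k l)"
    using has_bochner_integral_erlang_density[OF l] by (rule integrable.intros)
  \<comment> \<open>A real power is nonnegative for every base, so the exponential factor of
    \<open>h\<close> is at most 1 everywhere and the Erlang density dominates
    \<open>h\<close>.\<close>
  moreover have "0 \<le> ?G x" for x by (simp add: capacity_sq_dist_def)
  ultimately have "integrable lborel h"
    using m l by (elim Bochner_Integration.integrable_bound) (auto simp: h_def abs_mult intro!: mult_left_le)
  then have h: "set_integrable lborel (?G ` {\<rho><..}) h"
    unfolding image set_integrable_def by (intro integrable_mult_indicator) auto
  have inj: "inj_on ?G {\<rho><..}"
    using \<rho> by (intro inj_on_inverseI[where g="sq_dist_capacity c b"]) (auto simp: sq_dist_capacity_inverse[OF c b])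
  have "?lhs = (LINT u:?G ` {\<rho><..}|lborel. h u)"
    unfolding image set_lebesgue_integral_def h_def by (simp add: mult_ac)
  also have "\<dots> = (LINT z:{\<rho><..}|lborel. \<bar>G' z\<bar> * h (?G z))"
  proof (rule set_lborel_integral_change_of_variables[OF _ _ inj _ _ _ h])
    show "(?G has_real_derivative G' z) (at z)" if "z \<in> {\<rho><..}" for z
      unfolding G'_def using that \<rho> by (intro DERIV_capacity_sq_dist[OF c b]) simp
  qed measurable
  also have "\<dots> = (LINT z:{\<rho><..}|lborel. ?C * ?g z)"
  proof (rule set_lebesgue_integral_cong)
    show "\<forall>z. z \<in> {\<rho><..} \<longrightarrow> \<bar>G' z\<bar> * h (?G z) = ?C * ?g z"
    proof (intro allI impI)
      fix z assume "z \<in> {\<rho><..}"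
      with \<rho> have z: "0 < z" by simp
      let ?t = "2 powr z - 1"
      have t: "0 < ?t" using powr_two_gt_one[OF z] by simp
      have e: "exp (- l * ?G z) * exp (- m * ?G (z - \<rho>)) =
          exp (- (l * (c / ?t) powr (1 / b)) - m * (c / (2 powr (z - \<rho>) - 1)) powr (1 / b))"
        by (simp add: capacity_sq_dist_def flip: exp_add)
      \<comment> \<open>The derivative contributes the exponent \<open>- 1 / b - 1\<close> and the
        factor \<open>u ^ k\<close> contributes \<open>- k / b\<close>.\<close>
      have "- 1 / b - 1 + - (real k / b) = - (1 + real (Suc k) / b)"
        by (simp add: add_divide_distrib)
      then have "?t powr (- 1 / b - 1) * ?t powr - (real k / b) = ?t powr - (1 + real (Suc k) / b)"
        by (simp only: powr_add[symmetric])
      then have p: "?t powr (- 1 / b - 1) * ?t powr - (real k / b) = 1 / ?t powr (1 + real (Suc k) / b)"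
        by (simp only: powr_minus_divide)
      have q: "c powr (1 / b) * c powr (real k / b) = c powr (real (Suc k) / b)"
        by (simp add: powr_add[symmetric] add_divide_distrib)
      have G': "\<bar>G' z\<bar> = ln 2 / b * c powr (1 / b) * 2 powr z * ?t powr (- 1 / b - 1)"
        using b unfolding G'_def by (simp add: abs_mult)
      have h': "h (?G z) = l ^ Suc k * (c powr (real k / b) * ?t powr - (real k / b)) / fact k *
          (exp (- l * ?G z) * exp (- m * ?G (z - \<rho>)))"
        using capacity_sq_dist_pos[OF c b z] capacity_sq_dist_power[OF c b z, of k]
          sq_dist_capacity_inverse[OF c b z]
        by (simp add: h_def erlang_density_def)
      have alg: "(x1 / b * x2 * x3 * x4) * (x5 * (x6 * x7) / x8 * x9) =
          x1 * x5 / (x8 * b) * (x2 * x6) * (x3 * (x4 * x7) * x9)" for x1 x2 x3 x4 x5 x6 x7 x8 x9 :: real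
        by (simp add: mult_ac)
      have "\<bar>G' z\<bar> * h (?G z) = ln 2 * l ^ Suc k / (fact k * b) *
          (c powr (1 / b) * c powr (real k / b)) *
          (2 powr z * (?t powr (- 1 / b - 1) * ?t powr - (real k / b)) *
          (exp (- l * ?G z) * exp (- m * ?G (z - \<rho>))))"
        unfolding G' h' by (rule alg)
      then show "\<bar>G' z\<bar> * h (?G z) = ?C * ?g z"
        unfolding e p q by (simp only: times_divide_eq_right mult_1_right times_divide_eq_left)
    qed
  qed simp
  also have "\<dots> = ?C * (LINT z:{\<rho><..}|lborel. ?g z)" by (rule set_integral_mult_right)
  finally show ?thesis .
qed

section \<open>The probabilities of existence and of outage\<close>

theorem corollary5p1:
  fixes M :: "'w measure"
    and \<Phi>\<^sub>l \<Phi>\<^sub>e :: "'w \<Rightarrow> (real^2) set"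
    and lam\<^sub>l lam\<^sub>e P \<sigma> b :: real
    and i :: nat
  assumes "prob_space M"
    and "lam\<^sub>l > 0" and "lam\<^sub>e > 0" and "P > 0" and "\<sigma>\<^sup>2 > 0" and "b > 0" and "i \<ge> 1"
    and "poisson_point_process M lam\<^sub>l \<Phi>\<^sub>l"
    and "poisson_point_process M lam\<^sub>e \<Phi>\<^sub>e"
    and "prob_space.indep_var M config_space \<Phi>\<^sub>l config_space \<Phi>\<^sub>e"
  shows "\<P>(\<omega> in M. max_secrecy_rate P \<sigma> b (\<Phi>\<^sub>l \<omega>) (\<Phi>\<^sub>e \<omega>) i > 0) = (lam\<^sub>l / (lam\<^sub>l + lam\<^sub>e)) ^ i \<and>
    (\<forall>\<rho>>0. \<P>(\<omega> in M. max_secrecy_rate P \<sigma> b (\<Phi>\<^sub>l \<omega>) (\<Phi>\<^sub>e \<omega>) i < \<rho>) =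
      1 - ln 2 * (pi * lam\<^sub>l) ^ i / (fact (i - 1) * b) * (P / \<sigma>\<^sup>2) powr (real i / b) *
        (LINT z:{\<rho><..}|lborel.
          2 powr z / (2 powr z - 1) powr (1 + real i / b) *
          exp (- (pi * lam\<^sub>l * ((P / \<sigma>\<^sup>2) / (2 powr z - 1)) powr (1 / b))
               - pi * lam\<^sub>e * ((P / \<sigma>\<^sup>2) / (2 powr (z - \<rho>) - 1)) powr (1 / b))))"
proof (intro conjI allI impI)
  interpret prob_space M by fact
  define c where "c = P / \<sigma>\<^sup>2"
  define k where "k = i - 1"
  define U where "U \<omega> = (ordered_dist (\<Phi>\<^sub>l \<omega>) i)\<^sup>2" for \<omega>
  define V where "V \<omega> = (ordered_dist (\<Phi>\<^sub>e \<omega>) 1)\<^sup>2" for \<omega>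
  let ?l = "pi * lam\<^sub>l" and ?m = "pi * lam\<^sub>e"
  let ?K = "sq_dist_capacity c b" and ?G = "capacity_sq_dist c b"
  note ppl = \<open>poisson_point_process M lam\<^sub>l \<Phi>\<^sub>l\<close> \<open>lam\<^sub>l > 0\<close> \<open>i \<ge> 1\<close>
  note ppe = \<open>poisson_point_process M lam\<^sub>e \<Phi>\<^sub>e\<close> \<open>lam\<^sub>e > 0\<close> order_refl[of "1::nat"]
  have c: "0 < c" and b: "0 < b" and l: "0 < ?l" and m: "0 < ?m" and i: "i = Suc k"
    using assms(2-7) by (auto simp: c_def k_def)
  have U: "distributed M lborel U (erlang_density k ?l)"
    unfolding U_def[abs_def] k_def by (rule distributed_ordered_dist_square[OF ppl])
  have V: "distributed M lborel V (exponential_density ?m)"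
    unfolding V_def[abs_def] using distributed_ordered_dist_square[OF ppe]
    by simp
  have indep: "indep_var borel U borel V"
    using indep_var_compose[OF assms(10), of "\<lambda>X. (ordered_dist X i)\<^sup>2" borel "\<lambda>X. (ordered_dist X 1)\<^sup>2" borel]
      \<open>i \<ge> 1\<close>
    by (simp add: U_def[abs_def] V_def[abs_def] comp_def)
  have [measurable]: "U \<in> borel_measurable M" "V \<in> borel_measurable M"
    using indep by (auto dest: indep_var_rv1 indep_var_rv2)
  define S where "S \<omega> = max_secrecy_rate P \<sigma> b (\<Phi>\<^sub>l \<omega>) (\<Phi>\<^sub>e \<omega>) i" for \<omega>
  have [measurable]: "(\<lambda>\<omega>. ordered_dist (\<Phi>\<^sub>l \<omega>) i) \<in> borel_measurable M"
      "(\<lambda>\<omega>. ordered_dist (\<Phi>\<^sub>e \<omega>) 1) \<in> borel_measurable M"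
    using indep_var_rv1[OF assms(10)] indep_var_rv2[OF assms(10)] \<open>i \<ge> 1\<close>
    by (auto intro: measurable_compose borel_measurable_ordered_dist)
  have [measurable]: "S \<in> borel_measurable M"
    unfolding S_def[abs_def] max_secrecy_rate_def link_capacity_def path_gain_def by measurable
  \<comment> \<open>From here on the rate matters only through the independent variables
    \<open>U\<close> and \<open>V\<close>.\<close>
  have AE: "AE \<omega> in M. 0 < U \<omega> \<and> 0 < V \<omega> \<and> S \<omega> = max (?K (U \<omega>) - ?K (V \<omega>)) 0"
    using AE_ordered_dist_pos[OF ppl] AE_ordered_dist_pos[OF ppe]
    by eventually_elim (simp add: U_def V_def S_def max_secrecy_rate_def
        link_capacity_eq_sq_dist_capacity c_def)

  have "\<P>(\<omega> in M. 0 < S \<omega>) = \<P>(\<omega> in M. U \<omega> < V \<omega>)"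
  proof (rule prob_eq_AE)
    show "AE \<omega> in M. 0 < S \<omega> \<longleftrightarrow> U \<omega> < V \<omega>"
      using AE by eventually_elim (auto simp: sq_dist_capacity_less_iff[OF c b] less_max_iff_disj)
  qed measurable
  also have "\<dots> = (LINT u|lborel. erlang_density k ?l u * exp (- ?m * u))"
  proof (rule prob_indep_distributed[OF U _ _ indep])
    \<comment> \<open>Positivity of the density rules out \<open>u < 0\<close>, where the tail would
      be 1.\<close>
    show "\<P>(\<omega> in M. u < V \<omega>) = exp (- ?m * u)" if "0 < erlang_density k ?l u" for u
      using exponential_distributedD_gt[OF V, of u] m that
      by (auto simp: erlang_density_def mult_ac split: if_splits)
  qed (use l in auto)
  also have "\<dots> = (?l / (?l + ?m)) ^ i"
    unfolding i by (rule integral_erlang_density_mult_exp[OF l m])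
  also have "?l / (?l + ?m) = lam\<^sub>l / (lam\<^sub>l + lam\<^sub>e)"
    by (simp add: distrib_left[symmetric])
  finally show "\<P>(\<omega> in M. max_secrecy_rate P \<sigma> b (\<Phi>\<^sub>l \<omega>) (\<Phi>\<^sub>e \<omega>) i > 0) =
      (lam\<^sub>l / (lam\<^sub>l + lam\<^sub>e)) ^ i"
    by (simp only: S_def)

  fix \<rho> :: real assume \<rho>: "0 < \<rho>"
  have "\<P>(\<omega> in M. S \<omega> < \<rho>) = 1 - \<P>(\<omega> in M. \<rho> \<le> S \<omega>)"
  proof -
    have "{\<omega>\<in>space M. S \<omega> < \<rho>} = space M - {\<omega>\<in>space M. \<rho> \<le> S \<omega>}" by auto
    then show ?thesis by (simp add: prob_compl)
  qed
  also have "\<P>(\<omega> in M. \<rho> \<le> S \<omega>) =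
      \<P>(\<omega> in M. U \<omega> \<in> {0<..<?G \<rho>} \<and> ?G (?K (U \<omega>) - \<rho>) \<le> V \<omega>)"
  proof (rule prob_eq_AE)
    show "AE \<omega> in M. \<rho> \<le> S \<omega> \<longleftrightarrow> U \<omega> \<in> {0<..<?G \<rho>} \<and> ?G (?K (U \<omega>) - \<rho>) \<le> V \<omega>"
      using AE
    proof eventually_elim
      case (elim \<omega>)
      then have pos: "0 < U \<omega>" "0 < V \<omega>" by auto
      \<comment> \<open>As \<open>\<rho>\<close> is positive, the truncation at 0 cannot produce a
        rate of at least \<open>\<rho>\<close>.\<close>
      have "\<rho> \<le> S \<omega> \<longleftrightarrow> ?K (V \<omega>) \<le> ?K (U \<omega>) - \<rho>" using elim \<rho> by (auto simp: le_max_iff_disj)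
      \<comment> \<open>The capacity of the eavesdropper is positive, which forces
        \<open>?K (U \<omega>) - \<rho>\<close> to be positive, where \<open>?G\<close> is a genuine
        inverse.\<close>
      also have "\<dots> \<longleftrightarrow> \<rho> < ?K (U \<omega>) \<and> ?K (V \<omega>) \<le> ?K (U \<omega>) - \<rho>"
        using sq_dist_capacity_pos[OF c b pos(2)] by auto
      also have "\<dots> \<longleftrightarrow> \<rho> < ?K (U \<omega>) \<and> ?G (?K (U \<omega>) - \<rho>) \<le> V \<omega>"
        using sq_dist_capacity_le_iff[OF c b pos(2)] by auto
      also have "\<rho> < ?K (U \<omega>) \<longleftrightarrow> U \<omega> < ?G \<rho>"
        by (rule less_sq_dist_capacity_iff[OF c b pos(1) \<rho>])
      finally show ?case using pos by simp
    qed
  qed measurable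
  also have "\<dots> = (LINT u|lborel. erlang_density k ?l u *
      (indicator {0<..<?G \<rho>} u * exp (- ?m * ?G (?K u - \<rho>))))"
  proof (rule prob_indep_distributed[OF U _ _ indep])
    show "\<P>(\<omega> in M. u \<in> {0<..<?G \<rho>} \<and> ?G (?K u - \<rho>) \<le> V \<omega>) =
        indicator {0<..<?G \<rho>} u * exp (- ?m * ?G (?K u - \<rho>))" for u
    proof -
      \<comment> \<open>The threshold is nonnegative for every \<open>u\<close>, so the exponential
        tail formula applies throughout; the indicator removes the values of \<open>u\<close>
        outside the interval.\<close>
      have "0 \<le> ?G (?K u - \<rho>)" by (simp add: capacity_sq_dist_def)
      then have "\<P>(\<omega> in M. ?G (?K u - \<rho>) \<le> V \<omega>) = exp (- ?m * ?G (?K u - \<rho>))"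
        using exponential_distributed_ge[OF V m] by (simp add: mult.commute)
      then show ?thesis by (cases "u \<in> {0<..<?G \<rho>}") (simp_all del: greaterThanLessThan_iff)
    qed
  qed (use l in auto)
  also have "\<dots> = ln 2 * ?l ^ i / (fact k * b) * c powr (real i / b) *
      (LINT z:{\<rho><..}|lborel. 2 powr z / (2 powr z - 1) powr (1 + real i / b) *
        exp (- (?l * (c / (2 powr z - 1)) powr (1 / b)) - ?m * (c / (2 powr (z - \<rho>) - 1)) powr (1 / b)))"
    unfolding i by (rule integral_erlang_density_outage[OF c b l m \<rho>])
  finally show "\<P>(\<omega> in M. max_secrecy_rate P \<sigma> b (\<Phi>\<^sub>l \<omega>) (\<Phi>\<^sub>e \<omega>) i < \<rho>) =
      1 - ln 2 * (pi * lam\<^sub>l) ^ i / (fact (i - 1) * b) * (P / \<sigma>\<^sup>2) powr (real i / b) *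
        (LINT z:{\<rho><..}|lborel.
          2 powr z / (2 powr z - 1) powr (1 + real i / b) *
          exp (- (pi * lam\<^sub>l * ((P / \<sigma>\<^sup>2) / (2 powr z - 1)) powr (1 / b))
               - pi * lam\<^sub>e * ((P / \<sigma>\<^sup>2) / (2 powr (z - \<rho>) - 1)) powr (1 / b)))"
    by (simp only: S_def c_def k_def)
qed

end
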